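(* Suppose that each $\mathfrak g_i$ $(i=1,\dots,r)$ admits a decomposition $\mathfrak g_i=\mathfrak r_i\oplus\mathfrak s_i$, where $\mathfrak r_i=\mathrm{span}\{e_1^i,\dots,e_m^i\}$ and $\mathfrak s_i=\mathrm{span}\{e_{m+1}^i,\dots,e_n^i\}$, such that $$[\mathfrak s_i,\mathfrak s_i]\subseteq\mathfrak s_i,\qquad[\mathfrak s_i,\mathfrak r_i]\subseteq\mathfrak r_i,\qquad[\mathfrak r_i,\mathfrak r_i]\subseteq\mathfrak s_i .$$ Then for each $i=1,\dots,r$ the equation $$0=\frac{d}{dt}\left(\frac{\partial C_i}{\partial u_i}+\lambda_i\right)-\mathrm{ad}^*_{u_i}\left(\frac{\partial C_i}{\partial u_i}+\lambda_i\right)-\sum_{j>i}\left(T^*_{\overline e_i}L_{g_i}\left(\frac{\partial V_{ij}}{\partial g_i}\right)+T^*_{\overline e_j}L_{g_j}\left(\sum_{k=1}^{j-1}\frac{\partial V_{kj}}{\partial g_j}\right)\right)$$ can be equivalently rewritten as the system $$\frac{d}{dt}\frac{\partial C_i}{\partial u_i}=\mathrm{ad}^*_{u_i}\lambda_i\Big|_{\mathfrak r_i}+\sum_{j>i}T^*_{\overline e_j}L_{g_j}\left(\sum_{k=1}^{j-1}\frac{\partial V_{kj}}{\partial g_j}\right)\bigg|_{\mathfrak r_j}+\sum_{j>i}T^*_{\overline e_i}L_{g_i}\left(\frac{\partial V_{ij}}{\partial g_i}\right)\bigg|_{\mathfrak r_i},$$ $$\dot\lambda_i=\mathrm{ad}^*_{u_i}\frac{\partial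 C_i}{\partial u_i}\Big|_{\mathfrak s_i}+\sum_{j>i}T^*_{\overline e_j}L_{g_j}\left(\sum_{k=1}^{j-1}\frac{\partial V_{kj}}{\partial g_j}\right)\bigg|_{\mathfrak s_j}+\sum_{j>i}T^*_{\overline e_i}L_{g_i}\left(\frac{\partial V_{ij}}{\partial g_i}\right)\bigg|_{\mathfrak s_i}.$$
   Context: Setting. There are $r$ agents. Agent $i$ evolves on a Lie group $G_i$ of dimension $n$ with identity $\overline e_i$ and Lie algebra $\mathfrak g_i=T_{\overline e_i}G_i$. All the $G_i$ have the same Lie group structure (they are copies of one Lie group), so all $\mathfrak g_i$, and all duals $\mathfrak g_i^*$, are identified with each other, with the bases below corresponding to each other; terms in $\mathfrak g_i^*$ and $\mathfrak g_j^*$ are added using this identification. Notation. $L_g(h)=gh$ is left translation, $T_hL_g$ its tangent map, and $T_h^*L_g$ its cotangent map, defined by $\langle T_h^*L_g(\alpha),\beta\rangle=\langle\alpha,T_hL_g(\beta)\rangle$; in particular $T^*_{\overline e_i}L_{g_i}$ sends $T^*_{g_i}G_i$ to $\mathfrak g_i^*$. $\langle\cdot,\cdot\rangle$ is the natural pairing of covectors and vectors. $\mathrm{ad}_\xi\eta=[\xi,\eta]$, and $\mathrm{ad}^*_\xi$ is defined by $\langle\mathrm{ad}^*_\xi\mu,\eta\rangle=\langle\mu,\mathrm{ad}_\xi\eta\rangle$. Control system and multipliers. Each $\mathfrak g_i$ has a basis $e_1^i,\dots,e_n^i$ with dual basis $e_i^1,\dots,e_i^n$ of $\mathfrak g_i^*$,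 and $1\le m<n$ is fixed. The curves $g_i(t)\in G_i$ satisfy $\dot g_i=T_{\overline e_i}L_{g_i}(u_i)$ with controls $u_i=\sum_{w=1}^m u_i^we_w^i$ (so $u_i(t)\in\mathrm{span}\{e_1^i,\dots,e_m^i\}$), and the multipliers are $C^1$ curves $\lambda_i=\sum_{w=m+1}^n\lambda_i^we_i^w$ in $\mathfrak g_i^*$. The curves $u_i$ are smooth enough for the time derivatives to make sense. Cost data. The functions $C_i:G_i\times\mathfrak g_i\to\mathbb R$ are smooth and invariant under the left action $\rho_{g_i}(h_i,u_i)=(g_ih_i,u_i)$ of $G_i$. The cost derivative is taken with respect to the control inputs $u_i^1,\dots,u_i^m$: $\frac{\partial C_i}{\partial u_i}=\sum_{w=1}^m\frac{\partial C_i}{\partial u_i^w}e_i^w\in\mathfrak g_i^*$. For $i\neq j$ in $\{1,\dots,r\}$, $V_{ij}:G_i\times G_j\to\mathbb R$ is a sufficiently regular (e.g. smooth) function with $V_{ij}=V_{ji}$; $\partial V_{ij}/\partial g_i\in T^*_{g_i}G_i$ and $\partial V_{ij}/\partial g_j\in T^*_{g_j}G_j$ are its partial differentials, evaluated at $(g_i,g_j)$. Restrictions. For $\alpha\in\mathfrak g_i^*$, $\alpha|_{\mathfrak r_i}$ and $\alpha|_{\mathfrak s_i}$ denote the components of $\alpha$ in $\mathrm{span}\{e_i^1,\dots,e_i^m\}\cong\mathfrak r_i^*$ and $\mathrm{span}\{e_i^{m+1},\dots,e_i^n\}\cong\mathfrak s_i^*$ respectively. *)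

theory Defs
  imports "HOL-Analysis.Analysis"
begin

text \<open>
  Calculus of class \<open>C\<^sup>k\<close> on an open set \<open>S\<close>: \<open>f\<close> is \<open>C\<^bsup>k+1\<^esup>\<close> iff it is
  differentiable and all its directional derivatives are \<open>C\<^sup>k\<close>.
\<close>

primrec Ck_on :: "nat \<Rightarrow> 'a::euclidean_space set \<Rightarrow> ('a \<Rightarrow> 'b::real_normed_vector) \<Rightarrow> bool" where
  "Ck_on 0 S f \<longleftrightarrow> continuous_on S f"
| "Ck_on (Suc k) S f \<longleftrightarrow>
     (\<forall>x\<in>S. f differentiable (at x)) \<and> (\<forall>v. Ck_on k S (\<lambda>x. frechet_derivative f (at x) v))"

text \<open>
  A chart is a pair of an open domain and a coordinate map that is a homeomorphism of the domain
  onto an open subset of the model space; values of the coordinate map off the domain are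
  irrelevant. Manifolds live on a whole type, with an atlas that need not be maximal.
\<close>

type_synonym ('a, 'e) chart = "'a set \<times> ('a \<Rightarrow> 'e)"

definition chart_inv :: "('a, 'e) chart \<Rightarrow> 'e \<Rightarrow> 'a" where
  "chart_inv c = inv_into (fst c) (snd c)"

definition is_chart :: "('a::topological_space, 'e::euclidean_space) chart \<Rightarrow> bool" where
  "is_chart c \<longleftrightarrow> open (fst c) \<and> open (snd c ` fst c) \<and>
     homeomorphism (fst c) (snd c ` fst c) (snd c) (chart_inv c)"

locale smooth_manifold =
  fixes A :: "('a::{t2_space, second_countable_topology}, 'e::euclidean_space) chart set"
  assumes charts: "c \<in> A \<Longrightarrow> is_chart c"
    and covering: "\<exists>c\<in>A. p \<in> fst c"
    and compatible: "c \<in> A \<Longrightarrow> d \<in> A \<Longrightarrow>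
      Ck_on k (snd c ` (fst c \<inter> fst d)) (snd d \<circ> chart_inv c)"

definition model_atlas :: "('e::euclidean_space, 'e) chart set" where
  "model_atlas = {(UNIV, id)}"

definition prod_atlas ::
  "('a, 'e) chart set \<Rightarrow> ('b, 'f) chart set \<Rightarrow> ('a \<times> 'b, 'e \<times> 'f) chart set" where
  "prod_atlas A B =
     {(fst c \<times> fst d, \<lambda>(x, y). (snd c x, snd d y)) | c d. c \<in> A \<and> d \<in> B}"

definition Ck_map :: "nat \<Rightarrow> ('a::topological_space, 'e::euclidean_space) chart set \<Rightarrow>
    ('b::topological_space, 'f::euclidean_space) chart set \<Rightarrow> ('a \<Rightarrow> 'b) \<Rightarrow> bool" where
  "Ck_map k A B f \<longleftrightarrow> continuous_on UNIV f \<and>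
     (\<forall>c\<in>A. \<forall>d\<in>B. Ck_on k (snd c ` (fst c \<inter> f -` fst d)) (snd d \<circ> f \<circ> chart_inv c))"

definition smooth_map :: "('a::topological_space, 'e::euclidean_space) chart set \<Rightarrow>
    ('b::topological_space, 'f::euclidean_space) chart set \<Rightarrow> ('a \<Rightarrow> 'b) \<Rightarrow> bool" where
  "smooth_map A B f \<longleftrightarrow> (\<forall>k. Ck_map k A B f)"

locale lie_group = smooth_manifold A + group gmul one inverse
  for A :: "('g::{t2_space, second_countable_topology}, 'e::euclidean_space) chart set"
    and gmul :: "'g \<Rightarrow> 'g \<Rightarrow> 'g" and one :: 'g and inverse :: "'g \<Rightarrow> 'g" +
  assumes smooth_mult: "smooth_map (prod_atlas A A) A (\<lambda>(x, y). gmul x y)"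
    and smooth_inverse: "smooth_map A A inverse"

text \<open>
  Every tangent space is identified with the model space \<open>'e\<close>: a tangent vector at \<open>p\<close> is given by
  its components in one chart chosen once and for all at \<open>p\<close>. Tangent maps
  are then derivatives between chosen charts. In particular \<open>'e\<close>, read as the tangent space at
  the identity, is the Lie algebra, and \<open>'e \<Rightarrow>\<^sub>L real\<close> is its dual.
\<close>

definition chart_at :: "('a, 'e) chart set \<Rightarrow> 'a \<Rightarrow> ('a, 'e) chart" where
  "chart_at A p = (SOME c. c \<in> A \<and> p \<in> fst c)"

definition tangent_map :: "('a, 'e::euclidean_space) chart set \<Rightarrow>
    ('b, 'f::euclidean_space) chart set \<Rightarrow> ('a \<Rightarrow> 'b) \<Rightarrow> 'a \<Rightarrow> 'e \<Rightarrow> 'f" where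
  "tangent_map A B f p =
     frechet_derivative (snd (chart_at B (f p)) \<circ> f \<circ> chart_inv (chart_at A p))
       (at (snd (chart_at A p) p))"

text \<open>The cotangent map at \<open>p\<close> takes covectors at \<open>f p\<close> to covectors at \<open>p\<close>.\<close>

definition cotangent_map :: "('a, 'e::euclidean_space) chart set \<Rightarrow>
    ('b, 'f::euclidean_space) chart set \<Rightarrow> ('a \<Rightarrow> 'b) \<Rightarrow> 'a \<Rightarrow>
    ('f \<Rightarrow>\<^sub>L real) \<Rightarrow> ('e \<Rightarrow>\<^sub>L real)" where
  "cotangent_map A B f p \<alpha> = Blinfun (\<lambda>v. blinfun_apply \<alpha> (tangent_map A B f p v))"

definition differential ::
  "('a, 'e::euclidean_space) chart set \<Rightarrow> ('a \<Rightarrow> real) \<Rightarrow> 'a \<Rightarrow> ('e \<Rightarrow>\<^sub>L real)" where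
  "differential A f p = Blinfun (tangent_map A model_atlas f p)"

definition has_velocity :: "('a::topological_space, 'e::euclidean_space) chart set \<Rightarrow>
    (real \<Rightarrow> 'a) \<Rightarrow> 'e \<Rightarrow> real \<Rightarrow> real set \<Rightarrow> bool" where
  "has_velocity A g v t I \<longleftrightarrow> continuous (at t within I) g \<and>
     ((\<lambda>s. snd (chart_at A (g t)) (g s)) has_vector_derivative v) (at t within I)"

text \<open>
  Lie bracket of vector fields at \<open>p\<close>, by the coordinate formula
  \<open>[X,Y] = DY(X) - DX(Y)\<close> in the chosen chart at \<open>p\<close>. The map \<open>field_rep\<close> is the
  coordinate representation of a field in a chart; it has to convert each value \<open>X q\<close>, given by
  its components in the chosen chart at \<open>q\<close>, to components in the chart \<open>c\<close>.
\<close>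

definition field_rep :: "('a, 'e::euclidean_space) chart set \<Rightarrow> ('a, 'e) chart \<Rightarrow>
    ('a \<Rightarrow> 'e) \<Rightarrow> 'e \<Rightarrow> 'e" where
  "field_rep A c X x =
     (let q = chart_inv c x in tangent_map A model_atlas (snd c) q (X q))"

definition field_bracket :: "('a, 'e::euclidean_space) chart set \<Rightarrow>
    ('a \<Rightarrow> 'e) \<Rightarrow> ('a \<Rightarrow> 'e) \<Rightarrow> 'a \<Rightarrow> 'e" where
  "field_bracket A X Y p =
     (let c = chart_at A p; x = snd c p; X' = field_rep A c X; Y' = field_rep A c Y
      in frechet_derivative Y' (at x) (X' x) - frechet_derivative X' (at x) (Y' x))"

definition left_invariant_field :: "('g, 'e::euclidean_space) chart set \<Rightarrow>
    ('g \<Rightarrow> 'g \<Rightarrow> 'g) \<Rightarrow> 'g \<Rightarrow> 'e \<Rightarrow> 'g \<Rightarrow> 'e" where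
  "left_invariant_field A gmul one \<xi> g = tangent_map A A (gmul g) one \<xi>"

definition lie_bracket :: "('g, 'e::euclidean_space) chart set \<Rightarrow>
    ('g \<Rightarrow> 'g \<Rightarrow> 'g) \<Rightarrow> 'g \<Rightarrow> 'e \<Rightarrow> 'e \<Rightarrow> 'e" where
  "lie_bracket A gmul one \<xi> \<eta> =
     field_bracket A (left_invariant_field A gmul one \<xi>) (left_invariant_field A gmul one \<eta>) one"

definition ad_star :: "('g, 'e::euclidean_space) chart set \<Rightarrow>
    ('g \<Rightarrow> 'g \<Rightarrow> 'g) \<Rightarrow> 'g \<Rightarrow> 'e \<Rightarrow> ('e \<Rightarrow>\<^sub>L real) \<Rightarrow> ('e \<Rightarrow>\<^sub>L real)" where
  "ad_star A gmul one \<xi> \<mu> = Blinfun (\<lambda>\<eta>. blinfun_apply \<mu> (lie_bracket A gmul one \<xi> \<eta>))"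

definition left_cotranslation :: "('g, 'e::euclidean_space) chart set \<Rightarrow>
    ('g \<Rightarrow> 'g \<Rightarrow> 'g) \<Rightarrow> 'g \<Rightarrow> 'g \<Rightarrow> ('e \<Rightarrow>\<^sub>L real) \<Rightarrow> ('e \<Rightarrow>\<^sub>L real)" where
  "left_cotranslation A gmul one g = cotangent_map A A (gmul g) one"

definition is_indexed_basis :: "nat \<Rightarrow> (nat \<Rightarrow> 'e::euclidean_space) \<Rightarrow> bool" where
  "is_indexed_basis n e \<longleftrightarrow>
     inj_on e {1..n} \<and> independent (e ` {1..n}) \<and> span (e ` {1..n}) = UNIV"

definition is_dual_basis ::
  "nat \<Rightarrow> (nat \<Rightarrow> 'e::euclidean_space) \<Rightarrow> (nat \<Rightarrow> 'e \<Rightarrow>\<^sub>L real) \<Rightarrow> bool" where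
  "is_dual_basis n e \<epsilon> \<longleftrightarrow>
     (\<forall>v\<in>{1..n}. \<forall>w\<in>{1..n}. blinfun_apply (\<epsilon> w) (e v) = (if v = w then 1 else 0))"

text \<open>
  Component of a covector in \<open>span (\<epsilon> ` W)\<close>, along the remaining dual basis vectors: the
  coefficient of \<open>\<epsilon> w\<close> in \<open>\<alpha>\<close> is \<open>\<alpha> (e w)\<close>.
\<close>

definition covector_component :: "(nat \<Rightarrow> 'e::euclidean_space) \<Rightarrow> (nat \<Rightarrow> 'e \<Rightarrow>\<^sub>L real) \<Rightarrow>
    nat set \<Rightarrow> ('e \<Rightarrow>\<^sub>L real) \<Rightarrow> ('e \<Rightarrow>\<^sub>L real)" where
  "covector_component e \<epsilon> W \<alpha> = (\<Sum>w\<in>W. blinfun_apply \<alpha> (e w) *\<^sub>R \<epsilon> w)"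

text \<open>
  The partial derivative with respect to the control input with index \<open>w\<close> at
  \<open>u = (\<Sum>w=1..m. u\<^sub>w *\<^sub>R e w)\<close> is the derivative along \<open>e w\<close>.
\<close>

definition cost_derivative :: "nat \<Rightarrow> (nat \<Rightarrow> 'e::euclidean_space) \<Rightarrow> (nat \<Rightarrow> 'e \<Rightarrow>\<^sub>L real) \<Rightarrow>
    ('g \<Rightarrow> 'e \<Rightarrow> real) \<Rightarrow> 'g \<Rightarrow> 'e \<Rightarrow> ('e \<Rightarrow>\<^sub>L real)" where
  "cost_derivative m e \<epsilon> C g u =
     (\<Sum>w=1..m. deriv (\<lambda>s. C g (u + s *\<^sub>R e w)) 0 *\<^sub>R \<epsilon> w)"

definition C1_curve_on :: "real set \<Rightarrow> (real \<Rightarrow> 'b::real_normed_vector) \<Rightarrow> bool" where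
  "C1_curve_on I f \<longleftrightarrow> (\<exists>f'. continuous_on I f' \<and>
     (\<forall>t\<in>I. (f has_vector_derivative f' t) (at t within I)))"

end

theory Submission
  imports Defs
begin

text \<open>
  The cost derivative \<open>\<partial>C\<^sub>i/\<partial>u\<^sub>i\<close> annihilates \<open>\<ss>\<close> at all times, the multiplier \<open>\<lambda>\<^sub>i\<close>
  annihilates \<open>\<rr>\<close> at all times, and their time derivatives inherit this. For \<open>u\<^sub>i \<in> \<rr>\<close> the
  bracket relations \<open>[\<rr>, \<rr>] \<subseteq> \<ss>\<close> and, by antisymmetry, \<open>[\<rr>, \<ss>] \<subseteq> \<rr>\<close> say that \<open>[u\<^sub>i, _]\<close>
  exchanges \<open>\<rr>\<close> and \<open>\<ss>\<close>; dually, the coadjoint map of \<open>u\<^sub>i\<close> sends the cost derivative to a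
  covector that annihilates \<open>\<rr>\<close> and sends the multiplier to one that annihilates \<open>\<ss>\<close>. A covector
  equation holds iff it holds on the basis vectors spanning \<open>\<rr>\<close> and on those spanning \<open>\<ss>\<close>.
  Evaluated on the former, the given equation loses \<open>d\<lambda>\<^sub>i/dt\<close> and the coadjoint term of the cost
  derivative; evaluated on the latter, it loses the other two terms. These two halves are the two
  equations of the system. The potential terms contribute to both halves.

  Two analytic facts carry this argument. Additivity of the coadjoint map, and
  indeed its very meaning as a bounded functional, need the bracket of left invariant fields to be
  linear (\<open>linear_lie_bracket\<close>): in the chart at the identity, such a field is the partial
  derivative of the \<open>C\<^sup>2\<close> group product in its second argument, taken at the identity. And the derivative of a
  sum of curves splits only if both curves are differentiable
  (\<open>cost_derivative_differentiable\<close>): invariance makes the cost a smooth function of the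
  control alone, so the chain rule applies along any differentiable control.
\<close>

section \<open>Charts\<close>

lemma chart_inv_left: "is_chart c \<Longrightarrow> p \<in> fst c \<Longrightarrow> chart_inv c (snd c p) = p"
  by (simp add: is_chart_def homeomorphism_def)

lemma chart_inv_in: "is_chart c \<Longrightarrow> x \<in> snd c ` fst c \<Longrightarrow> chart_inv c x \<in> fst c"
  by (auto simp: chart_inv_left)

lemma chart_inv_right: "is_chart c \<Longrightarrow> x \<in> snd c ` fst c \<Longrightarrow> snd c (chart_inv c x) = x"
  by (auto simp: chart_inv_left)

lemma open_chart_image:
  assumes c: "is_chart c" and W: "open W"
  shows "open (snd c ` (fst c \<inter> W))"
proof -
  have h: "homeomorphism (fst c) (snd c ` fst c) (snd c) (chart_inv c)"
    and o: "open (snd c ` fst c)"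
    using c by (auto simp: is_chart_def)
  have "openin (top_of_set (fst c)) (fst c \<inter> W)"
    using W by blast
  then have "openin (top_of_set (snd c ` fst c)) (snd c ` (fst c \<inter> W))"
    by (rule homeomorphism_imp_open_map[OF h])
  then show ?thesis
    using o openin_open_trans by blast
qed

text \<open>
  The inverse chart is a choice function, so even for a product chart it is determined only on the
  image of the chart domain, by injectivity there.
\<close>

lemma chart_inv_prod:
  assumes c: "is_chart c" and d: "is_chart d"
    and x: "x \<in> snd c ` fst c" and y: "y \<in> snd d ` fst d"
  shows "chart_inv (fst c \<times> fst d, \<lambda>(p, q). (snd c p, snd d q)) (x, y)
    = (chart_inv c x, chart_inv d y)"
proof -
  have "inj_on (\<lambda>(p, q). (snd c p, snd d q)) (fst c \<times> fst d)"
    by (rule inj_onI) (auto, (metis chart_inv_left c d)+)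
  moreover have "(x, y) = (\<lambda>(p, q). (snd c p, snd d q)) (chart_inv c x, chart_inv d y)"
    using assms by (simp add: chart_inv_right)
  ultimately show ?thesis
    unfolding chart_inv_def[of "(fst c \<times> fst d, _)"]
    by (simp only: fst_conv snd_conv, intro inv_into_f_f) (use assms chart_inv_in[OF c] chart_inv_in[OF d] in auto)
qed

lemma is_chart_id: "is_chart (UNIV, id :: 'a::euclidean_space \<Rightarrow> 'a)"
proof -
  have "chart_inv (UNIV, id :: 'a \<Rightarrow> 'a) = id"
    by (auto simp: chart_inv_def fun_eq_iff)
  then show ?thesis
    by (simp add: is_chart_def homeomorphism_def)
qed

lemma chart_inv_id: "chart_inv (UNIV, id) (x :: 'a::euclidean_space) = x"
  using chart_inv_left[OF is_chart_id, of x] by simp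

lemma chart_at_model: "chart_at model_atlas x = (UNIV, id)"
  unfolding chart_at_def model_atlas_def by (rule some_equality) auto

lemma (in smooth_manifold) chart_at_in:
  "chart_at A p \<in> A" "p \<in> fst (chart_at A p)"
proof -
  have "\<exists>c. c \<in> A \<and> p \<in> fst c"
    using covering by blast
  then have "chart_at A p \<in> A \<and> p \<in> fst (chart_at A p)"
    unfolding chart_at_def by (rule someI_ex)
  then show "chart_at A p \<in> A" "p \<in> fst (chart_at A p)"
    by auto
qed

section \<open>Derivatives\<close>

lemma Ck_on_differentiable:
  "Ck_on (Suc k) S f \<Longrightarrow> x \<in> S \<Longrightarrow> f differentiable (at x)"
  by simp

lemma Ck_on_derivative_differentiable:
  "Ck_on (Suc (Suc k)) S f \<Longrightarrow> x \<in> S \<Longrightarrow>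
    (\<lambda>x. frechet_derivative f (at x) v) differentiable (at x)"
  by simp

lemma partial_derivative_snd:
  assumes "F differentiable (at (x, y))"
  shows "((\<lambda>y. F (x, y)) has_derivative (\<lambda>v. frechet_derivative F (at (x, y)) (0, v))) (at y)"
proof -
  have F: "(F has_derivative frechet_derivative F (at (x, y))) (at (x, y))"
    using assms by (rule iffD1[OF frechet_derivative_works])
  have "((\<lambda>y. (x, y)) has_derivative (\<lambda>v. (0, v))) (at y)"
    by (auto intro!: derivative_eq_intros)
  from has_derivative_compose[OF this F] show ?thesis .
qed

text \<open>
  The two functions have the same candidate derivatives, so the choice among them returns the same
  result, whether or not a candidate exists.
\<close>

lemma frechet_derivative_cong_open:
  assumes "open U" "x \<in> U" "\<And>y. y \<in> U \<Longrightarrow> f y = g y"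
  shows "frechet_derivative f (at x) = frechet_derivative g (at x)"
proof -
  have "(f has_derivative f') (at x) \<longleftrightarrow> (g has_derivative f') (at x)" for f'
    using assms by (metis has_derivative_transform_within_open)
  then show ?thesis
    by (simp add: frechet_derivative_def)
qed

section \<open>The Lie bracket\<close>

lemma lie_bracket_antisym:
  "lie_bracket A gmul one \<xi> \<eta> = - lie_bracket A gmul one \<eta> \<xi>"
  by (simp add: lie_bracket_def field_bracket_def Let_def)

context lie_group
begin

text \<open>
  The function \<open>F\<close> is the group product in coordinates. It is obtained together with just the
  regularity used below, one derivative to push tangent vectors forward and a second one to bracket
  left invariant fields.
\<close>

lemma mult_rep:
  assumes c: "c \<in> A" and d: "d \<in> A"
  obtains F where
    "\<And>p q. p \<in> fst c \<Longrightarrow> q \<in> fst c \<Longrightarrow> gmul p q \<in> fst d \<Longrightarrow>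
      F differentiable (at (snd c p, snd c q))"
    "\<And>p q v. p \<in> fst c \<Longrightarrow> q \<in> fst c \<Longrightarrow> gmul p q \<in> fst d \<Longrightarrow>
      (\<lambda>z. frechet_derivative F (at z) v) differentiable (at (snd c p, snd c q))"
    "\<And>p q. p \<in> fst c \<Longrightarrow> q \<in> fst c \<Longrightarrow> F (snd c p, snd c q) = snd d (gmul p q)"
proof -
  let ?cc = "(fst c \<times> fst c, \<lambda>(x, y). (snd c x, snd c y))"
  let ?F = "snd d \<circ> (\<lambda>(x, y). gmul x y) \<circ> chart_inv ?cc"
  let ?W = "snd ?cc ` (fst ?cc \<inter> (\<lambda>(x, y). gmul x y) -` fst d)"
  have "?cc \<in> prod_atlas A A"
    using c unfolding prod_atlas_def by blast
  then have F: "Ck_on 2 ?W ?F"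
    using smooth_mult d unfolding smooth_map_def Ck_map_def by blast
  have W: "(snd c p, snd c q) \<in> ?W"
    if "p \<in> fst c" "q \<in> fst c" "gmul p q \<in> fst d" for p q
    using that by force
  show thesis
  proof
    show "?F differentiable (at (snd c p, snd c q))"
      if "p \<in> fst c" "q \<in> fst c" "gmul p q \<in> fst d" for p q
      using Ck_on_differentiable[of 1, OF _ W[OF that]] F by (simp add: numeral_2_eq_2)
    show "(\<lambda>z. frechet_derivative ?F (at z) v) differentiable (at (snd c p, snd c q))"
      if "p \<in> fst c" "q \<in> fst c" "gmul p q \<in> fst d" for p q v
      using Ck_on_derivative_differentiable[of 0, OF _ W[OF that]] F by (simp add: numeral_2_eq_2)
    show "?F (snd c p, snd c q) = snd d (gmul p q)"
      if "p \<in> fst c" "q \<in> fst c" for p q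
      using that charts[OF c]
      by (simp add: chart_inv_prod chart_inv_left)
  qed
qed

lemma continuous_left_translation: "continuous_on UNIV (gmul q)"
proof -
  have "continuous_on UNIV (\<lambda>(x, y). gmul x y)"
    using smooth_mult unfolding smooth_map_def Ck_map_def by blast
  then have "continuous_on UNIV ((\<lambda>(x, y). gmul x y) \<circ> (\<lambda>y. (q, y)))"
    by (intro continuous_on_compose continuous_intros) (auto intro: continuous_on_subset)
  then show ?thesis
    by (simp add: o_def)
qed

text \<open>
  The value of the field at \<open>q\<close> is computed in the chart chosen at \<open>q\<close> and then converted to the
  chart \<open>c\<close>. By the chain rule the intermediate chart cancels, which leaves the derivative of
  \<open>y \<mapsto> q y\<close> at the identity, expressed in the single chart \<open>c\<close>; unlike the chosen charts, this
  depends differentiably on \<open>q\<close>.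
\<close>

lemma left_invariant_field_rep:
  assumes c: "c = chart_at A one" and q: "q \<in> fst c"
    and F: "F differentiable (at (snd c q, snd c one))"
      "\<And>p p'. p \<in> fst c \<Longrightarrow> p' \<in> fst c \<Longrightarrow> F (snd c p, snd c p') = snd c (gmul p p')"
  shows "field_rep A c (left_invariant_field A gmul one \<xi>) (snd c q)
    = frechet_derivative F (at (snd c q, snd c one)) (0, \<xi>)"
proof -
  define d where "d = chart_at A q"
  have cA: "c \<in> A" and c1: "one \<in> fst c" and dA: "d \<in> A" and dq: "q \<in> fst d"
    using chart_at_in c d_def by auto
  have chc: "is_chart c" and chd: "is_chart d"
    using charts cA dA by auto
  obtain G where G: "G differentiable (at (snd c q, snd c one))"
    and Geq: "\<And>p p'. p \<in> fst c \<Longrightarrow> p' \<in> fst c \<Longrightarrow> G (snd c p, snd c p') = snd d (gmul p p')"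
    using mult_rep[OF cA dA] q c1 dq by (metis right_neutral)
  \<comment> \<open>The tangent map of left translation is the derivative of \<open>?L\<close>; \<open>?T\<close> changes chart from \<open>d\<close> to \<open>c\<close>.\<close>
  let ?T = "snd c \<circ> chart_inv d"
  let ?L = "snd d \<circ> gmul q \<circ> chart_inv c"
  have "Ck_on 1 (snd d ` (fst d \<inter> fst c)) ?T"
    by (rule compatible[OF dA cA])
  then have T: "?T differentiable (at (snd d q))"
    using dq q by auto
  let ?U = "snd c ` (fst c \<inter> UNIV)"
  have L: "(?L has_derivative (\<lambda>v. frechet_derivative G (at (snd c q, snd c one)) (0, v)))
      (at (snd c one))"
    by (rule has_derivative_transform_within_open[OF partial_derivative_snd[OF G]
          open_chart_image[OF chc open_UNIV]])
      (use c1 q Geq chart_inv_left[OF chc] in auto)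
  \<comment> \<open>Only where \<open>q y\<close> stays in the domain of \<open>d\<close> does the chart \<open>d\<close> cancel in \<open>?T \<circ> ?L\<close>.\<close>
  let ?W = "snd c ` (fst c \<inter> gmul q -` fst d)"
  have "open (gmul q -` fst d)"
    using continuous_left_translation chd
    by (simp add: continuous_on_open_vimage is_chart_def)
  then have W: "open ?W"
    by (rule open_chart_image[OF chc])
  have TL: "(?T \<circ> ?L has_derivative frechet_derivative ?T (at (snd d q)) \<circ>
      frechet_derivative ?L (at (snd c one))) (at (snd c one))"
  proof (rule diff_chain_at)
    show "(?L has_derivative frechet_derivative ?L (at (snd c one))) (at (snd c one))"
      using L frechet_derivative_at by metis
    have "?L (snd c one) = snd d q"
      using c1 chart_inv_left[OF chc] by simp
    then show "(?T has_derivative frechet_derivative ?T (at (snd d q))) (at (?L (snd c one)))"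
      using T frechet_derivative_works by metis
  qed
  have "((\<lambda>y. F (snd c q, y)) has_derivative frechet_derivative ?T (at (snd d q)) \<circ>
      frechet_derivative ?L (at (snd c one))) (at (snd c one))"
    by (rule has_derivative_transform_within_open[OF TL W])
      (use c1 q dq F(2) chart_inv_left[OF chc] chart_inv_left[OF chd] in auto)
  from has_derivative_unique[OF this partial_derivative_snd[OF F(1)]]
  have "frechet_derivative ?T (at (snd d q)) (frechet_derivative ?L (at (snd c one)) \<xi>)
    = frechet_derivative F (at (snd c q, snd c one)) (0, \<xi>)"
    by (simp add: fun_eq_iff)
  then show ?thesis
    using chart_inv_left[OF chc q]
    by (simp add: field_rep_def tangent_map_def left_invariant_field_def chart_at_model
        c[symmetric] d_def[symmetric] Let_def o_def)
qed

text \<open>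
  Both terms of the coordinate formula \<open>DY(X) - DX(Y)\<close> are linear in \<open>Y\<close> once \<open>X\<close> and \<open>Y\<close> are known to
  be differentiable; for that the coordinate fields are replaced, near the identity, by partial
  derivatives of the product.
\<close>

lemma linear_lie_bracket: "linear (lie_bracket A gmul one \<xi>)"
proof -
  define c where "c = chart_at A one"
  have cA: "c \<in> A" and c1: "one \<in> fst c"
    using chart_at_in c_def by auto
  have ch: "is_chart c"
    using charts cA by auto
  define x0 where "x0 = snd c one"
  define X where "X \<eta> = field_rep A c (left_invariant_field A gmul one \<eta>)" for \<eta>
  obtain F where F: "\<And>q. q \<in> fst c \<Longrightarrow> F differentiable (at (snd c q, x0))"
    and F2: "\<And>v. (\<lambda>z. frechet_derivative F (at z) v) differentiable (at (x0, x0))"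
    and Feq: "\<And>p p'. p \<in> fst c \<Longrightarrow> p' \<in> fst c \<Longrightarrow> F (snd c p, snd c p') = snd c (gmul p p')"
    using mult_rep[OF cA cA] c1 unfolding x0_def by (metis right_neutral)
  let ?U = "snd c ` (fst c \<inter> UNIV)"
  define D where "D \<eta> x = frechet_derivative F (at (x, x0)) (0, \<eta>)" for \<eta> x
  have U: "open ?U" "x0 \<in> ?U"
    using open_chart_image[OF ch open_UNIV] c1 by (auto simp: x0_def)
  have XD: "X \<eta> x = D \<eta> x" if "x \<in> ?U" for \<eta> x
    using that left_invariant_field_rep[OF c_def _ F[unfolded x0_def] Feq]
    by (auto simp: X_def D_def x0_def)
  have "(\<lambda>x. D \<eta> x) differentiable (at x0)" for \<eta>
  proof -
    have "(\<lambda>x. (x, x0)) differentiable (at x0)"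
      by (auto intro!: derivative_eq_intros simp: differentiable_def)
    from differentiable_compose[OF _ this, of "\<lambda>z. frechet_derivative F (at z) (0, \<eta>)"] F2
    show ?thesis
      by (simp add: D_def)
  qed
  then have D': "(D \<eta> has_derivative frechet_derivative (D \<eta>) (at x0)) (at x0)" for \<eta>
    using frechet_derivative_works by blast
  have linF: "linear (frechet_derivative F (at (x, x0)))" if "x \<in> ?U" for x
    using that F linear_frechet_derivative by auto
  have D_add: "D (a + b) x = D a x + D b x" if "x \<in> ?U" for a b x
    using linear_add[OF linF[OF that], of "(0, a)" "(0, b)"] by (simp add: D_def)
  have D_scale: "D (k *\<^sub>R a) x = k *\<^sub>R D a x" if "x \<in> ?U" for k a x
    using linear_scale[OF linF[OF that], of k "(0, a)"] by (simp add: D_def)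
  have fD_add: "frechet_derivative (D (a + b)) (at x0) v
      = frechet_derivative (D a) (at x0) v + frechet_derivative (D b) (at x0) v" for a b v
  proof -
    have "frechet_derivative (D (a + b)) (at x0) = frechet_derivative (\<lambda>x. D a x + D b x) (at x0)"
      by (rule frechet_derivative_cong_open[OF U D_add])
    also have "\<dots> = (\<lambda>v. frechet_derivative (D a) (at x0) v + frechet_derivative (D b) (at x0) v)"
      by (rule frechet_derivative_at[symmetric, OF has_derivative_add[OF D' D']])
    finally show ?thesis
      by simp
  qed
  have fD_scale: "frechet_derivative (D (k *\<^sub>R a)) (at x0) v
      = k *\<^sub>R frechet_derivative (D a) (at x0) v" for k a v
  proof -
    have "frechet_derivative (D (k *\<^sub>R a)) (at x0) = frechet_derivative (\<lambda>x. k *\<^sub>R D a x) (at x0)"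
      by (rule frechet_derivative_cong_open[OF U D_scale])
    also have "\<dots> = (\<lambda>v. k *\<^sub>R frechet_derivative (D a) (at x0) v)"
      by (rule frechet_derivative_at[symmetric, OF has_derivative_scaleR_right[OF D']])
    finally show ?thesis
      by simp
  qed
  have lin: "linear (frechet_derivative (D \<xi>) (at x0))"
    using has_derivative_linear[OF D'] .
  have "lie_bracket A gmul one \<xi> \<eta>
    = frechet_derivative (D \<eta>) (at x0) (D \<xi> x0) - frechet_derivative (D \<xi>) (at x0) (D \<eta> x0)" for \<eta>
    using frechet_derivative_cong_open[OF U XD] XD[OF U(2)]
    by (simp add: lie_bracket_def field_bracket_def Let_def c_def[symmetric] x0_def[symmetric]
        X_def[symmetric])
  then show ?thesis
    by (intro linearI)
      (simp_all add: fD_add fD_scale D_add[OF U(2)] D_scale[OF U(2)] linear_add[OF lin]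
        linear_scale[OF lin] scaleR_diff_right)
qed

lemma ad_star_apply:
  "blinfun_apply (ad_star A gmul one \<xi> \<mu>) \<eta> = blinfun_apply \<mu> (lie_bracket A gmul one \<xi> \<eta>)"
proof -
  have "bounded_linear (lie_bracket A gmul one \<xi>)"
    using linear_lie_bracket linear_conv_bounded_linear by blast
  then have "bounded_linear (\<lambda>\<eta>. blinfun_apply \<mu> (lie_bracket A gmul one \<xi> \<eta>))"
    using bounded_linear_compose blinfun.bounded_linear_right by blast
  then show ?thesis
    unfolding ad_star_def by (simp add: bounded_linear_Blinfun_apply)
qed

section \<open>The cost derivative along a curve\<close>

text \<open>
  Invariance gives \<open>C h = C one\<close>, so \<open>C h\<close> is the slice of the coordinate representation of \<open>C\<close>
  through the identity.
\<close>

lemma invariant_cost_twice_differentiable: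
  fixes C :: "'g \<Rightarrow> 'e \<Rightarrow> real"
  assumes smooth: "smooth_map (prod_atlas A model_atlas) model_atlas (\<lambda>(h, \<xi>). C h \<xi>)"
    and inv: "\<And>h h' \<xi>. C (gmul h h') \<xi> = C h' \<xi>"
  shows "C h differentiable (at \<xi>)"
    and "(\<lambda>\<xi>. frechet_derivative (C h) (at \<xi>) v) differentiable (at \<xi>)"
proof -
  define c where "c = chart_at A one"
  have cA: "c \<in> A" and c1: "one \<in> fst c"
    using chart_at_in c_def by auto
  have ch: "is_chart c"
    using charts cA by auto
  let ?m = "(UNIV :: 'e set, id :: 'e \<Rightarrow> 'e)" and ?n = "(UNIV :: real set, id :: real \<Rightarrow> real)"
  let ?cc = "(fst c \<times> fst ?m, \<lambda>(x, y). (snd c x, snd ?m y))"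
  let ?F = "snd ?n \<circ> (\<lambda>(h, \<xi>). C h \<xi>) \<circ> chart_inv ?cc"
  let ?W = "snd ?cc ` (fst ?cc \<inter> (\<lambda>(h, \<xi>). C h \<xi>) -` fst ?n)"
  have "?cc \<in> prod_atlas A model_atlas"
    using cA unfolding prod_atlas_def model_atlas_def by blast
  moreover have "?n \<in> model_atlas"
    by (simp add: model_atlas_def)
  ultimately have F: "Ck_on 2 ?W ?F"
    using smooth unfolding smooth_map_def Ck_map_def by blast
  have W: "(snd c one, \<xi>) \<in> ?W" for \<xi>
    using c1 by force
  have C1: "C h \<xi> = C one \<xi>" for h \<xi>
    using inv[of h one \<xi>] by simp
  have eq: "C h = (\<lambda>\<xi>. ?F (snd c one, \<xi>))"
    using chart_inv_prod[OF ch is_chart_id[where 'a = 'e], of "snd c one"] c1 chart_inv_left[OF ch c1]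
    by (auto simp: chart_inv_id fun_eq_iff C1[of h])
  have dF: "?F differentiable (at (snd c one, \<xi>))" for \<xi>
    using Ck_on_differentiable[of 1, OF _ W] F by (simp add: numeral_2_eq_2)
  have dC: "(C h has_derivative (\<lambda>v. frechet_derivative ?F (at (snd c one, \<xi>)) (0, v))) (at \<xi>)" for \<xi>
    unfolding eq by (rule partial_derivative_snd[OF dF])
  then show "C h differentiable (at \<xi>)"
    by (rule differentiableI)
  have "(\<lambda>z. frechet_derivative ?F (at z) (0, v)) differentiable (at (snd c one, \<xi>))"
    using Ck_on_derivative_differentiable[of 0, OF _ W] F by (simp add: numeral_2_eq_2)
  moreover have "(\<lambda>\<xi>. (snd c one, \<xi>)) differentiable (at \<xi>)"
    by (auto intro!: derivative_eq_intros simp: differentiable_def)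
  ultimately have "(\<lambda>\<xi>. frechet_derivative ?F (at (snd c one, \<xi>)) (0, v)) differentiable (at \<xi>)"
    by (rule differentiable_compose)
  then show "(\<lambda>\<xi>. frechet_derivative (C h) (at \<xi>) v) differentiable (at \<xi>)"
    by (simp add: frechet_derivative_at[OF dC, symmetric])
qed

text \<open>
  By invariance the cost derivative is a function of the control alone, and a differentiable one
  because \<open>C one\<close> is twice differentiable; the claim is the chain rule along \<open>u\<close>.
\<close>

lemma cost_derivative_differentiable:
  fixes C :: "'g \<Rightarrow> 'e \<Rightarrow> real" and \<epsilon> :: "nat \<Rightarrow> 'e \<Rightarrow>\<^sub>L real"
  assumes smooth: "smooth_map (prod_atlas A model_atlas) model_atlas (\<lambda>(h, \<xi>). C h \<xi>)"
    and inv: "\<And>h h' \<xi>. C (gmul h h') \<xi> = C h' \<xi>"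
    and u: "u differentiable (at t within I)"
  shows "(\<lambda>s. cost_derivative m e \<epsilon> C (g s) (u s)) differentiable (at t within I)"
proof -
  have deriv: "deriv (\<lambda>s. C h (\<xi> + s *\<^sub>R v)) 0 = frechet_derivative (C one) (at \<xi>) v" for h \<xi> v
  proof -
    have C1: "C h \<xi> = C one \<xi>" for \<xi>
      using inv[of h one \<xi>] by simp
    have dC: "(C one has_derivative frechet_derivative (C one) (at \<xi>)) (at (\<xi> + 0 *\<^sub>R v))"
      using invariant_cost_twice_differentiable(1)[OF smooth inv] frechet_derivative_works
      by auto
    have "((\<lambda>s. \<xi> + s *\<^sub>R v) has_derivative (\<lambda>s. s *\<^sub>R v)) (at (0::real))"
      by (auto intro!: derivative_eq_intros)
    from has_derivative_compose[OF this dC]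
    have "((\<lambda>s. C one (\<xi> + s *\<^sub>R v)) has_derivative
        (\<lambda>s. frechet_derivative (C one) (at \<xi>) (s *\<^sub>R v))) (at (0::real))" .
    then have "((\<lambda>s. C one (\<xi> + s *\<^sub>R v)) has_field_derivative
        frechet_derivative (C one) (at \<xi>) v) (at (0::real))"
      using linear_scale[OF has_derivative_linear[OF dC]]
      by (simp add: has_field_derivative_def mult.commute[of _ "frechet_derivative _ _ _"])
    then show ?thesis
      by (simp add: C1 DERIV_imp_deriv)
  qed
  have "(\<lambda>s. frechet_derivative (C one) (at (u s)) (e w)) differentiable (at t within I)" for w
  proof -
    have "((\<lambda>\<xi>. frechet_derivative (C one) (at \<xi>) (e w)) \<circ> u) differentiable (at t within I)"
      using u invariant_cost_twice_differentiable(2)[OF smooth inv]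
      by (intro differentiable_chain_within) (auto intro: differentiable_at_withinI)
    then show ?thesis
      by (simp add: o_def)
  qed
  then show ?thesis
    unfolding cost_derivative_def deriv
    by (intro differentiable_sum differentiable_scaleR) auto
qed

end

section \<open>Components of covectors\<close>

lemma covector_vanish_on_span:
  assumes "\<And>w. w \<in> W \<Longrightarrow> blinfun_apply \<mu> (e w) = 0" and "x \<in> span (e ` W)"
  shows "blinfun_apply \<mu> x = 0"
  using assms(2)
proof (induction rule: span_induct)
  case base
  show ?case
    by (auto simp: subspace_def blinfun.add_right blinfun.scaleR_right)
next
  case (step x)
  then show ?case
    using assms(1) by auto
qed

lemma covector_component_apply:
  assumes "is_dual_basis n e \<epsilon>" "W \<subseteq> {1..n}" "v \<in> {1..n}"
  shows "blinfun_apply (covector_component e \<epsilon> W \<alpha>) (e v)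
    = (if v \<in> W then blinfun_apply \<alpha> (e v) else 0)"
proof -
  have "finite W"
    using assms(2) finite_subset by blast
  have "blinfun_apply (covector_component e \<epsilon> W \<alpha>) (e v)
    = (\<Sum>w\<in>W. if w = v then blinfun_apply \<alpha> (e v) else 0)"
    unfolding covector_component_def blinfun.sum_left blinfun.scaleR_left
    using assms by (intro sum.cong) (auto simp: is_dual_basis_def subset_iff)
  also have "\<dots> = (if v \<in> W then blinfun_apply \<alpha> (e v) else 0)"
    using \<open>finite W\<close> by simp
  finally show ?thesis .
qed

lemma covector_eqI:
  assumes "is_indexed_basis n e"
    and "\<And>w. w \<in> {1..n} \<Longrightarrow> blinfun_apply \<alpha> (e w) = blinfun_apply \<beta> (e w)"
  shows "\<alpha> = \<beta>"
proof (rule blinfun_eqI)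
  fix x
  have "x \<in> span (e ` {1..n})"
    using assms(1) by (simp add: is_indexed_basis_def)
  then have "blinfun_apply (\<alpha> - \<beta>) x = 0"
    by (rule covector_vanish_on_span[rotated]) (simp add: assms(2) blinfun.diff_left)
  then show "blinfun_apply \<alpha> x = blinfun_apply \<beta> x"
    by (simp add: blinfun.diff_left)
qed

lemma derivative_vanish:
  assumes f: "(f has_vector_derivative f') (at t within I)" and nb: "at t within I \<noteq> bot"
    and t: "t \<in> I" and z: "\<And>s. s \<in> I \<Longrightarrow> blinfun_apply (f s) x = 0"
  shows "blinfun_apply f' x = 0"
proof -
  have "((\<lambda>s. blinfun_apply (f s) x) has_vector_derivative blinfun_apply f' x) (at t within I)"
    by (rule bounded_linear.has_vector_derivative[OF blinfun.bounded_linear_left f])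
  then have "((\<lambda>s. 0) has_vector_derivative blinfun_apply f' x) (at t within I)"
    by (rule has_vector_derivative_transform[OF t, rotated]) (simp add: z)
  with has_vector_derivative_const[of 0] show ?thesis
    using vector_derivative_unique_within[OF nb] by blast
qed

section \<open>Splitting the equation of motion\<close>

theorem mainTheorem2:
  fixes A :: "('g::{t2_space, second_countable_topology}, 'e::euclidean_space) chart set"
    and gmul :: "'g \<Rightarrow> 'g \<Rightarrow> 'g" and one :: 'g and inverse :: "'g \<Rightarrow> 'g"
    and r n m :: nat
    and e :: "nat \<Rightarrow> 'e" and \<epsilon> :: "nat \<Rightarrow> 'e \<Rightarrow>\<^sub>L real"
    and R S :: "'e set"
    and C :: "nat \<Rightarrow> 'g \<Rightarrow> 'e \<Rightarrow> real"
    and V :: "nat \<Rightarrow> nat \<Rightarrow> 'g \<Rightarrow> 'g \<Rightarrow> real"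
    and I :: "real set"
    and g :: "nat \<Rightarrow> real \<Rightarrow> 'g" and u :: "nat \<Rightarrow> real \<Rightarrow> 'e"
    and lam :: "nat \<Rightarrow> real \<Rightarrow> 'e \<Rightarrow>\<^sub>L real"
  defines "br \<equiv> lie_bracket A gmul one"
    and "ads \<equiv> ad_star A gmul one"
    and "TL \<equiv> left_cotranslation A gmul one"
    and "dC \<equiv> \<lambda>i t. cost_derivative m e \<epsilon> (C i) (g i t) (u i t)"
    and "dV1 \<equiv> \<lambda>i j t. differential A (\<lambda>h. V i j h (g j t)) (g i t)"
    and "dV2 \<equiv> \<lambda>i j t. differential A (\<lambda>h. V i j (g i t) h) (g j t)"
    and "res_r \<equiv> covector_component e \<epsilon> {1..m}"
    and "res_s \<equiv> covector_component e \<epsilon> {m+1..n}"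
  assumes G: "lie_group A gmul one inverse"
    and n: "n = DIM('e)" and m: "1 \<le> m" "m < n"
    and basis: "is_indexed_basis n e" and dual: "is_dual_basis n e \<epsilon>"
    and I: "is_interval I" "\<exists>a\<in>I. \<exists>b\<in>I. a < b"
    and control: "\<And>i t. i \<in> {1..r} \<Longrightarrow> t \<in> I \<Longrightarrow> u i t \<in> span (e ` {1..m})"
    and u_diff: "\<And>i t. i \<in> {1..r} \<Longrightarrow> t \<in> I \<Longrightarrow> u i differentiable (at t within I)"
    and dynamics: "\<And>i t. i \<in> {1..r} \<Longrightarrow> t \<in> I \<Longrightarrow>
      has_velocity A (g i) (tangent_map A A (gmul (g i t)) one (u i t)) t I"
    and lam_span: "\<And>i t. i \<in> {1..r} \<Longrightarrow> t \<in> I \<Longrightarrow> lam i t \<in> span (\<epsilon> ` {m+1..n})"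
    and lam_C1: "\<And>i. i \<in> {1..r} \<Longrightarrow> C1_curve_on I (lam i)"
    and C_smooth: "\<And>i. i \<in> {1..r} \<Longrightarrow>
      smooth_map (prod_atlas A model_atlas) model_atlas (\<lambda>(h, \<xi>). C i h \<xi>)"
    and C_invariant: "\<And>i h h' \<xi>. i \<in> {1..r} \<Longrightarrow> C i (gmul h h') \<xi> = C i h' \<xi>"
    and V_regular: "\<And>i j. i \<in> {1..r} \<Longrightarrow> j \<in> {1..r} \<Longrightarrow> i \<noteq> j \<Longrightarrow>
      Ck_map 1 (prod_atlas A A) model_atlas (\<lambda>(h, h'). V i j h h')"
    and V_sym: "\<And>i j h h'. i \<in> {1..r} \<Longrightarrow> j \<in> {1..r} \<Longrightarrow> i \<noteq> j \<Longrightarrow>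
      V i j h h' = V j i h' h"
    and R: "R = span (e ` {1..m})" and S: "S = span (e ` {m+1..n})"
    and SS: "\<And>\<xi> \<eta>. \<xi> \<in> S \<Longrightarrow> \<eta> \<in> S \<Longrightarrow> br \<xi> \<eta> \<in> S"
    and SR: "\<And>\<xi> \<eta>. \<xi> \<in> S \<Longrightarrow> \<eta> \<in> R \<Longrightarrow> br \<xi> \<eta> \<in> R"
    and RR: "\<And>\<xi> \<eta>. \<xi> \<in> R \<Longrightarrow> \<eta> \<in> R \<Longrightarrow> br \<xi> \<eta> \<in> S"
  shows "\<forall>i\<in>{1..r}. \<forall>t\<in>I.
    0 = vector_derivative (\<lambda>s. dC i s + lam i s) (at t within I)
        - ads (u i t) (dC i t + lam i t)
        - (\<Sum>j\<in>{i<..r}. TL (g i t) (dV1 i j t) + TL (g j t) (\<Sum>k=1..j-1. dV2 k j t))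
    \<longleftrightarrow>
    vector_derivative (dC i) (at t within I)
      = res_r (ads (u i t) (lam i t))
        + (\<Sum>j\<in>{i<..r}. res_r (TL (g j t) (\<Sum>k=1..j-1. dV2 k j t)))
        + (\<Sum>j\<in>{i<..r}. res_r (TL (g i t) (dV1 i j t)))
    \<and>
    vector_derivative (lam i) (at t within I)
      = res_s (ads (u i t) (dC i t))
        + (\<Sum>j\<in>{i<..r}. res_s (TL (g j t) (\<Sum>k=1..j-1. dV2 k j t)))
        + (\<Sum>j\<in>{i<..r}. res_s (TL (g i t) (dV1 i j t)))"
proof (intro ballI)
  fix i t
  assume i: "i \<in> {1..r}" and t: "t \<in> I"
  interpret lie_group A gmul one inverse
    by (rule G)
  \<comment> \<open>At an isolated point of \<open>I\<close> the derivative within \<open>I\<close> would not be unique.\<close>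
  have "connected I" "\<not> (\<exists>a. I = {a})"
    using I is_interval_connected by auto
  then have nb: "at t within I \<noteq> bot"
    using connected_imp_perfect[of I t] t trivial_limit_within by blast

  define a where "a = vector_derivative (dC i) (at t within I)"
  define b where "b = vector_derivative (lam i) (at t within I)"
  have "dC i differentiable (at t within I)"
    unfolding dC_def
    by (rule cost_derivative_differentiable[OF C_smooth[OF i] C_invariant[OF i] u_diff[OF i t]])
  then have dC': "(dC i has_vector_derivative a) (at t within I)"
    unfolding a_def using vector_derivative_works by blast
  have "lam i differentiable (at t within I)"
    using lam_C1[OF i] t unfolding C1_curve_on_def
    by (meson differentiableI_vector)
  then have lam': "(lam i has_vector_derivative b) (at t within I)"
    unfolding b_def using vector_derivative_works by blast
  have ab: "vector_derivative (\<lambda>s. dC i s + lam i s) (at t within I) = a + b"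
    by (rule vector_derivative_within[OF nb has_vector_derivative_add[OF dC' lam']])

  have dC_s: "blinfun_apply (dC i s) (e w) = 0" if "w \<in> {m+1..n}" for s w
    unfolding dC_def cost_derivative_def blinfun.sum_left blinfun.scaleR_left
    using that dual by (intro sum.neutral) (auto simp: is_dual_basis_def)
  have lam_r: "blinfun_apply (lam i s) (e w) = 0" if s: "s \<in> I" and w: "w \<in> {1..m}" for s w
    using lam_span[OF i s]
  proof (induction rule: span_induct)
    case base
    show ?case
      by (auto simp: subspace_def blinfun.add_left blinfun.scaleR_left)
  next
    case (step x)
    then show ?case
      using w m dual by (auto simp: is_dual_basis_def)
  qed
  have a_s: "blinfun_apply a (e w) = 0" if "w \<in> {m+1..n}" for w
    by (rule derivative_vanish[OF dC' nb t dC_s[OF that]])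
  have b_r: "blinfun_apply b (e w) = 0" if "w \<in> {1..m}" for w
    by (rule derivative_vanish[OF lam' nb t lam_r[OF _ that]])

  have uR: "u i t \<in> R"
    using control[OF i t] R by simp
  have ads_apply: "blinfun_apply (ads (u i t) \<mu>) \<eta> = blinfun_apply \<mu> (br (u i t) \<eta>)" for \<mu> \<eta>
    unfolding ads_def br_def by (rule ad_star_apply)
  have ads_add: "ads (u i t) (dC i t + lam i t) = ads (u i t) (dC i t) + ads (u i t) (lam i t)"
    by (rule blinfun_eqI) (simp add: ads_apply blinfun.add_left)
  have adC_r: "blinfun_apply (ads (u i t) (dC i t)) (e w) = 0" if "w \<in> {1..m}" for w
  proof -
    have "br (u i t) (e w) \<in> span (e ` {m+1..n})"
      using RR[OF uR] that span_base[of "e w" "e ` {1..m}"] by (auto simp: R S)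
    then show ?thesis
      unfolding ads_apply by (rule covector_vanish_on_span[rotated]) (rule dC_s)
  qed
  have alam_s: "blinfun_apply (ads (u i t) (lam i t)) (e w) = 0" if "w \<in> {m+1..n}" for w
  proof -
    have "br (e w) (u i t) \<in> R"
      using SR[OF _ uR] that span_base[of "e w" "e ` {m+1..n}"] by (auto simp: S)
    then have "br (u i t) (e w) \<in> span (e ` {1..m})"
      unfolding br_def lie_bracket_antisym[of A gmul one "u i t"] by (auto simp: R span_neg)
    then show ?thesis
      unfolding ads_apply by (rule covector_vanish_on_span[rotated]) (rule lam_r[OF t])
  qed

  let ?a = "\<lambda>j. TL (g i t) (dV1 i j t)" and ?b = "\<lambda>j. TL (g j t) (\<Sum>k=1..j-1. dV2 k j t)"
  have res_r_apply: "blinfun_apply (res_r \<alpha>) (e w) = (if w \<le> m then blinfun_apply \<alpha> (e w) else 0)"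
    and res_s_apply: "blinfun_apply (res_s \<alpha>) (e w) = (if w \<le> m then 0 else blinfun_apply \<alpha> (e w))"
    if "w \<in> {1..n}" for \<alpha> w
    using m that unfolding res_r_def res_s_def
    by (subst covector_component_apply[OF dual]; auto)+
  have eq_iff: "\<alpha> = \<beta> \<longleftrightarrow> (\<forall>w\<in>{1..m}. blinfun_apply \<alpha> (e w) = blinfun_apply \<beta> (e w)) \<and>
      (\<forall>w\<in>{m+1..n}. blinfun_apply \<alpha> (e w) = blinfun_apply \<beta> (e w))" for \<alpha> \<beta>
  proof -
    have "{1..n} = {1..m} \<union> {m+1..n}"
      using m by auto
    then show ?thesis
      using covector_eqI[OF basis, of \<alpha> \<beta>] by blast
  qed
  define P where "P = ads (u i t) (dC i t)"
  define Q where "Q = ads (u i t) (lam i t)"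
  \<comment> \<open>Both sides are compared by their values on the basis; the terms that drop out on each half are
    those shown above to vanish there.\<close>
  have "0 = a + b - (P + Q) - (\<Sum>j\<in>{i<..r}. ?a j + ?b j) \<longleftrightarrow>
    a = res_r Q + (\<Sum>j\<in>{i<..r}. res_r (?b j)) + (\<Sum>j\<in>{i<..r}. res_r (?a j)) \<and>
    b = res_s P + (\<Sum>j\<in>{i<..r}. res_s (?b j)) + (\<Sum>j\<in>{i<..r}. res_s (?a j))"
    (is "?Z \<longleftrightarrow> ?X \<and> ?Y")
  proof -
    let ?r = "\<forall>w\<in>{1..m}. blinfun_apply a (e w) = blinfun_apply Q (e w)
        + (\<Sum>j\<in>{i<..r}. blinfun_apply (?b j) (e w)) + (\<Sum>j\<in>{i<..r}. blinfun_apply (?a j) (e w))"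
    let ?s = "\<forall>w\<in>{m+1..n}. blinfun_apply b (e w) = blinfun_apply P (e w)
        + (\<Sum>j\<in>{i<..r}. blinfun_apply (?b j) (e w)) + (\<Sum>j\<in>{i<..r}. blinfun_apply (?a j) (e w))"
    have "?Z \<longleftrightarrow> ?r \<and> ?s"
      unfolding eq_iff
      by (intro arg_cong2[where f = "(\<and>)"] ball_cong refl)
        (simp_all add: blinfun.add_left blinfun.diff_left blinfun.sum_left sum.distrib
          a_s b_r adC_r[folded P_def] alam_s[folded Q_def], linarith+)
    moreover have "?X \<longleftrightarrow> ?r"
      unfolding eq_iff using m
      by (auto simp: blinfun.add_left blinfun.sum_left res_r_apply a_s)
    moreover have "?Y \<longleftrightarrow> ?s"
      unfolding eq_iff using m
      by (auto simp: blinfun.add_left blinfun.sum_left res_s_apply b_r)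
    ultimately show ?thesis
      by blast
  qed
  then show "0 = vector_derivative (\<lambda>s. dC i s + lam i s) (at t within I)
        - ads (u i t) (dC i t + lam i t)
        - (\<Sum>j\<in>{i<..r}. TL (g i t) (dV1 i j t) + TL (g j t) (\<Sum>k=1..j-1. dV2 k j t))
    \<longleftrightarrow>
    vector_derivative (dC i) (at t within I)
      = res_r (ads (u i t) (lam i t))
        + (\<Sum>j\<in>{i<..r}. res_r (TL (g j t) (\<Sum>k=1..j-1. dV2 k j t)))
        + (\<Sum>j\<in>{i<..r}. res_r (TL (g i t) (dV1 i j t)))
    \<and>
    vector_derivative (lam i) (at t within I)
      = res_s (ads (u i t) (dC i t))
        + (\<Sum>j\<in>{i<..r}. res_s (TL (g j t) (\<Sum>k=1..j-1. dV2 k j t)))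
        + (\<Sum>j\<in>{i<..r}. res_s (TL (g i t) (dV1 i j t)))"
    unfolding ab ads_add a_def[symmetric] b_def[symmetric] P_def Q_def .
qed

end
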